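(* Consider the following four structures on the real vector space with basis $\{e_1,e_2,e_3\}$, each consisting of a Lie bracket (making it a Heisenberg Lie algebra) and a commutative associative product $\circ$; all brackets and products of basis vectors not listed (and not obtained from those listed by antisymmetry of the bracket or commutativity of $\circ$) are zero: - $(\mathfrak n_{3,1}^{(1)},A_3)$: $[e_2,e_3]=e_1$; $e_2\circ e_2=e_1$, $e_3\circ e_3=e_1$. - $(\mathfrak n_{3,1}^{(1)},A_4)$: $[e_2,e_3]=e_1$; $e_2\circ e_3=e_1$, $e_3\circ e_3=e_2$. - $(\mathfrak n_{3,1}^{(2)},D_1)$: $[e_1,e_3]=e_2$; $e_1\circ e_1=e_2$, $e_3\circ e_3=e_3$. - $(\mathfrak n_{3,1}^{(2)},D_2)$: $[e_1,e_3]=e_2$; $e_1\circ e_1=e_2$, $e_1\circ e_3=e_1$, $e_2\circ e_3=e_2$, $e_3\circ e_3=e_3$. These are $F_{\text{man}}$-algebras, and with $L$ the Leibnizator, $\nabla$ the canonical F-connection, $R$ its curvature, $\mathcal D_{\text{Pois}}$ the Poisson-algebra distribution and $\mathfrak{hol}(\nabla)$ the holonomy Lie algebra of each, the following hold: (1) $(\mathfrak n_{3,1}^{(1)},A_3)$ is a Poisson algebra ($L\equiv0$), and $\nabla$ is flat ($R\equiv0$). (2) $(\mathfrak n_{3,1}^{(1)},A_4)$ is not a Poisson algebra ($L\not\equiv0$), $\mathcal D_{\text{Pois}}$ has rank two, and $\nabla$ is flat ($R\equiv0$). (3) $(\mathfrak n_{3,1}^{(2)},D_1)$ is not a Poisson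 algebra ($L\not\equiv0$), $\mathcal D_{\text{Pois}}$ has rank two, $\nabla$ has non-vanishing curvature ($R\not\equiv0$), and $\mathfrak{hol}(\nabla)$ is abelian of dimension one. (4) $(\mathfrak n_{3,1}^{(2)},D_2)$ is not a Poisson algebra ($L\not\equiv0$), $\mathcal D_{\text{Pois}}$ has rank two, $\nabla$ has non-vanishing curvature ($R\not\equiv0$), and $\mathfrak{hol}(\nabla)$ is abelian of dimension one.
   Context: An $F_{\text{man}}$-algebra is a triple $(\mathfrak g,\circ,[\cdot,\cdot])$ where $(\mathfrak g,\circ)$ is a commutative associative (not necessarily unital) real algebra, $(\mathfrak g,[\cdot,\cdot])$ is a Lie algebra, and the Leibnizator $L(u,v,w):=[u,v\circ w]-[u,v]\circ w-v\circ[u,w]$ satisfies the Hertling-Manin condition $L(u\circ v,w,y)=L(u,w,y)\circ v+u\circ L(v,w,y)$ for all $u,v,w,y\in\mathfrak g$. It is a Poisson algebra if and only if $L\equiv0$. Let $G$ be the simply connected Lie group with Lie algebra $\mathfrak g$, with $\circ$ extended to a left-invariant $C^\infty(G)$-bilinear product on vector fields. For $u\in\mathfrak g$, $u^+$ denotes the left-invariant vector field with value $u$ at the identity. The canonical F-connection is the left-invariant affine connection with $\nabla_{u^+}v^+=\tfrac12[u^+,v^+]+u^+\circ v^+$; correspondingly, for $u\in\mathfrak g$ put $A_u:=\tfrac12\operatorname{ad}_u+S_u\in\operatorname{End}(\mathfrak g)$ with $S_u(v)=u\circ v$. Its curvature at the identity is $R(u,v)=[A_u,A_v]-A_{[u,v]}\in\operatorname{End}(\mathfrak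 g)$. The holonomy algebra $\mathfrak{hol}(\nabla)$ at the identity is the smallest Lie subalgebra of $\operatorname{End}(\mathfrak g)$ containing all $R(v,w)$, $v,w\in\mathfrak g$, and closed under commutation with all $A_u$, $u\in\mathfrak g$. The Poisson-algebra distribution $\mathcal D_{\text{Pois}}$ is the left-invariant distribution on $G$ whose fiber at the identity is $\{u\in\mathfrak g: L(u,v,w)=0\ \forall v,w\in\mathfrak g\}$; its rank is the dimension of this subspace. *)

theory Defs
  imports "HOL-Analysis.Analysis"
begin

section \<open>F-manifold algebras\<close>

text \<open>The underlying vector space is a whole type. The class \<open>euclidean_space\<close> is only used as
  the library's class of finite-dimensional real vector spaces; the inner product plays no role.\<close>

definition lie_algebra :: "('a::euclidean_space \<Rightarrow> 'a \<Rightarrow> 'a) \<Rightarrow> bool" where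
  "lie_algebra br \<longleftrightarrow>
     bilinear br \<and>
     (\<forall>x. br x x = 0) \<and>
     (\<forall>x y z. br x (br y z) + br y (br z x) + br z (br x y) = 0)"

definition heisenberg_algebra :: "('a::euclidean_space \<Rightarrow> 'a \<Rightarrow> 'a) \<Rightarrow> bool" where
  "heisenberg_algebra br \<longleftrightarrow>
     lie_algebra br \<and>
     (\<exists>x y z. card {x, y, z} = 3 \<and> independent {x, y, z} \<and> span {x, y, z} = UNIV \<and>
        br x y = z \<and> br x z = 0 \<and> br y z = 0)"

definition comm_assoc_algebra :: "('a::euclidean_space \<Rightarrow> 'a \<Rightarrow> 'a) \<Rightarrow> bool" where
  "comm_assoc_algebra pr \<longleftrightarrow>
     bilinear pr \<and>
     (\<forall>x y. pr x y = pr y x) \<and>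
     (\<forall>x y z. pr (pr x y) z = pr x (pr y z))"

definition leibnizator ::
  "('a::euclidean_space \<Rightarrow> 'a \<Rightarrow> 'a) \<Rightarrow> ('a \<Rightarrow> 'a \<Rightarrow> 'a) \<Rightarrow> 'a \<Rightarrow> 'a \<Rightarrow> 'a \<Rightarrow> 'a" where
  "leibnizator br pr u v w = br u (pr v w) - pr (br u v) w - pr v (br u w)"

definition F_man_algebra ::
  "('a::euclidean_space \<Rightarrow> 'a \<Rightarrow> 'a) \<Rightarrow> ('a \<Rightarrow> 'a \<Rightarrow> 'a) \<Rightarrow> bool" where
  "F_man_algebra br pr \<longleftrightarrow>
     lie_algebra br \<and> comm_assoc_algebra pr \<and>
     (\<forall>u v w y. leibnizator br pr (pr u v) w y =
        pr (leibnizator br pr u w y) v + pr u (leibnizator br pr v w y))"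

definition poisson_algebra ::
  "('a::euclidean_space \<Rightarrow> 'a \<Rightarrow> 'a) \<Rightarrow> ('a \<Rightarrow> 'a \<Rightarrow> 'a) \<Rightarrow> bool" where
  "poisson_algebra br pr \<longleftrightarrow>
     lie_algebra br \<and> comm_assoc_algebra pr \<and>
     (\<forall>u v w. br u (pr v w) = pr (br u v) w + pr v (br u w))"


section \<open>The canonical F-connection\<close>

text \<open>Left-invariant objects on the simply connected Lie group are represented by their values at
  the identity. \<open>Blinfun\<close> is meaningful only on bounded linear maps; in finite dimension this holds
  for all arguments below as soon as the bracket and the product are bilinear
  (see \<open>F_conn_apply\<close>).\<close>

definition ad_op :: "('a::euclidean_space \<Rightarrow> 'a \<Rightarrow> 'a) \<Rightarrow> 'a \<Rightarrow> 'a \<Rightarrow>\<^sub>L 'a" where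
  "ad_op br u = Blinfun (\<lambda>v. br u v)"

definition mult_op :: "('a::euclidean_space \<Rightarrow> 'a \<Rightarrow> 'a) \<Rightarrow> 'a \<Rightarrow> 'a \<Rightarrow>\<^sub>L 'a" where
  "mult_op pr u = Blinfun (\<lambda>v. pr u v)"

definition F_conn ::
  "('a::euclidean_space \<Rightarrow> 'a \<Rightarrow> 'a) \<Rightarrow> ('a \<Rightarrow> 'a \<Rightarrow> 'a) \<Rightarrow> 'a \<Rightarrow> 'a \<Rightarrow>\<^sub>L 'a" where
  "F_conn br pr u = (1/2) *\<^sub>R ad_op br u + mult_op pr u"

lemma F_conn_apply:
  assumes "bilinear br" and "bilinear pr"
  shows "blinfun_apply (F_conn br pr u) v = (1/2) *\<^sub>R br u v + pr u v"
proof -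
  have "bounded_linear (br u)" "bounded_linear (pr u)"
    using assms by (simp_all add: bilinear_def linear_conv_bounded_linear)
  then show ?thesis
    by (simp add: F_conn_def ad_op_def mult_op_def bounded_linear_Blinfun_apply
        blinfun.add_left blinfun.scaleR_left)
qed

definition commutator :: "('a::euclidean_space \<Rightarrow>\<^sub>L 'a) \<Rightarrow> ('a \<Rightarrow>\<^sub>L 'a) \<Rightarrow> 'a \<Rightarrow>\<^sub>L 'a" where
  "commutator f g = (f o\<^sub>L g) - (g o\<^sub>L f)"

definition curvature ::
  "('a::euclidean_space \<Rightarrow> 'a \<Rightarrow> 'a) \<Rightarrow> ('a \<Rightarrow> 'a \<Rightarrow> 'a) \<Rightarrow> 'a \<Rightarrow> 'a \<Rightarrow> 'a \<Rightarrow>\<^sub>L 'a" where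
  "curvature br pr u v =
     commutator (F_conn br pr u) (F_conn br pr v) - F_conn br pr (br u v)"

definition lie_subalgebra_End :: "('a::euclidean_space \<Rightarrow>\<^sub>L 'a) set \<Rightarrow> bool" where
  "lie_subalgebra_End H \<longleftrightarrow> subspace H \<and> (\<forall>f\<in>H. \<forall>g\<in>H. commutator f g \<in> H)"

definition holonomy_algebra ::
  "('a::euclidean_space \<Rightarrow> 'a \<Rightarrow> 'a) \<Rightarrow> ('a \<Rightarrow> 'a \<Rightarrow> 'a) \<Rightarrow> ('a \<Rightarrow>\<^sub>L 'a) set" where
  "holonomy_algebra br pr =
     \<Inter>{H. lie_subalgebra_End H \<and>
         (\<forall>v w. curvature br pr v w \<in> H) \<and>
         (\<forall>u. \<forall>f\<in>H. commutator (F_conn br pr u) f \<in> H)}"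

definition abelian_End :: "('a::euclidean_space \<Rightarrow>\<^sub>L 'a) set \<Rightarrow> bool" where
  "abelian_End H \<longleftrightarrow> (\<forall>f\<in>H. \<forall>g\<in>H. commutator f g = 0)"

definition pois_fiber ::
  "('a::euclidean_space \<Rightarrow> 'a \<Rightarrow> 'a) \<Rightarrow> ('a \<Rightarrow> 'a \<Rightarrow> 'a) \<Rightarrow> 'a set" where
  "pois_fiber br pr = {u. \<forall>v w. leibnizator br pr u v w = 0}"

definition pois_rank ::
  "('a::euclidean_space \<Rightarrow> 'a \<Rightarrow> 'a) \<Rightarrow> ('a \<Rightarrow> 'a \<Rightarrow> 'a) \<Rightarrow> nat" where
  "pois_rank br pr = dim (pois_fiber br pr)"


section \<open>The four structures\<close>

text \<open>Each bracket and product is the bilinear extension of its full table of values on basis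
  vectors. In the index type \<open>3\<close> the numeral \<open>3\<close> denotes the same index as \<open>0\<close>; the indices
  \<open>1\<close>, \<open>2\<close>, \<open>3\<close> are distinct.\<close>

definition e :: "3 \<Rightarrow> real^3" where
  "e i = axis i 1"

definition bilinear_ext :: "(3 \<Rightarrow> 3 \<Rightarrow> real^3) \<Rightarrow> real^3 \<Rightarrow> real^3 \<Rightarrow> real^3" where
  "bilinear_ext c x y = (\<Sum>i\<in>UNIV. \<Sum>j\<in>UNIV. (x $ i * y $ j) *\<^sub>R c i j)"

definition bracket_n1 :: "real^3 \<Rightarrow> real^3 \<Rightarrow> real^3" where
  "bracket_n1 = bilinear_ext (\<lambda>i j.
     if (i, j) = (2, 3) then e 1
     else if (i, j) = (3, 2) then - e 1
     else 0)"

definition bracket_n2 :: "real^3 \<Rightarrow> real^3 \<Rightarrow> real^3" where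
  "bracket_n2 = bilinear_ext (\<lambda>i j.
     if (i, j) = (1, 3) then e 2
     else if (i, j) = (3, 1) then - e 2
     else 0)"

definition prod_A3 :: "real^3 \<Rightarrow> real^3 \<Rightarrow> real^3" where
  "prod_A3 = bilinear_ext (\<lambda>i j.
     if (i, j) = (2, 2) then e 1
     else if (i, j) = (3, 3) then e 1
     else 0)"

definition prod_A4 :: "real^3 \<Rightarrow> real^3 \<Rightarrow> real^3" where
  "prod_A4 = bilinear_ext (\<lambda>i j.
     if (i, j) \<in> {(2, 3), (3, 2)} then e 1
     else if (i, j) = (3, 3) then e 2
     else 0)"

definition prod_D1 :: "real^3 \<Rightarrow> real^3 \<Rightarrow> real^3" where
  "prod_D1 = bilinear_ext (\<lambda>i j.
     if (i, j) = (1, 1) then e 2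
     else if (i, j) = (3, 3) then e 3
     else 0)"

definition prod_D2 :: "real^3 \<Rightarrow> real^3 \<Rightarrow> real^3" where
  "prod_D2 = bilinear_ext (\<lambda>i j.
     if (i, j) = (1, 1) then e 2
     else if (i, j) \<in> {(1, 3), (3, 1)} then e 1
     else if (i, j) \<in> {(2, 3), (3, 2)} then e 2
     else if (i, j) = (3, 3) then e 3
     else 0)"

end

theory Submission
  imports Defs
begin

text \<open>In coordinates the Leibnizator of each non-Poisson structure is \<open>L(u, v, w) = \<plusminus> u\<^sub>i v\<^sub>3 w\<^sub>3 a\<close>
  with a fixed index \<open>i\<close> and a fixed vector \<open>a \<noteq> 0\<close>, so that the fiber of the Poisson-algebra
  distribution is the plane \<open>u\<^sub>i = 0\<close>. For the last two structures the
  curvature \<open>R(u, v)\<close> is always a multiple of one operator \<open>T\<close>, namely \<open>x \<mapsto> x\<^sub>3 e\<^sub>2\<close>, and the commutator of each \<open>A\<^sub>u\<close> with \<open>T\<close> is a multiple of \<open>T\<close>; hence the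
  holonomy algebra is the line spanned by \<open>T\<close>.\<close>

section \<open>Commutators and one-dimensional holonomy\<close>

lemma commutator_apply:
  "blinfun_apply (commutator f g) x =
     blinfun_apply f (blinfun_apply g x) - blinfun_apply g (blinfun_apply f x)"
  by (simp add: commutator_def blinfun.diff_left)

lemma commutator_scaleR_right: "commutator f (c *\<^sub>R g) = c *\<^sub>R commutator f g"
  by (rule blinfun_eqI)
    (simp add: commutator_apply blinfun.scaleR_left blinfun.scaleR_right algebra_simps)

lemma commutator_scaleR_scaleR_self: "commutator (a *\<^sub>R f) (b *\<^sub>R f) = 0"
  by (rule blinfun_eqI)
    (simp add: commutator_apply blinfun.scaleR_left blinfun.scaleR_right)

lemma curvature_apply:
  "blinfun_apply (curvature br pr u v) w =
    blinfun_apply (F_conn br pr u) (blinfun_apply (F_conn br pr v) w)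
    - blinfun_apply (F_conn br pr v) (blinfun_apply (F_conn br pr u) w)
    - blinfun_apply (F_conn br pr (br u v)) w"
  by (simp add: curvature_def commutator_apply blinfun.diff_left)

text \<open>Multiples of \<open>T\<close> commute, so the line through \<open>T\<close> is one of
  the subalgebras being intersected. Conversely, each of those contains a nonzero curvature
  operator, which is a multiple of \<open>T\<close>, and hence \<open>T\<close> itself.\<close>

lemma holonomy_algebra_eq_span:
  assumes curv: "\<And>u v. curvature br pr u v \<in> span {T}"
    and nonflat: "curvature br pr u0 v0 \<noteq> 0"
    and inv: "\<And>u. commutator (F_conn br pr u) T \<in> span {T}"
  shows "holonomy_algebra br pr = span {T}"
proof
  have "lie_subalgebra_End (span {T})"
    using subspace_span[of "{T}"]
    \<comment> \<open>All commutators vanish here; the coefficient \<open>0\<close> exhibits zero as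
      a point of the line.\<close>
    by (auto simp: lie_subalgebra_End_def span_singleton commutator_scaleR_scaleR_self
        intro: range_eqI[where x = 0])
  moreover have "commutator (F_conn br pr u) f \<in> span {T}" if "f \<in> span {T}" for u f
    using that inv[of u] by (auto simp: span_singleton commutator_scaleR_right)
  ultimately show "holonomy_algebra br pr \<subseteq> span {T}"
    unfolding holonomy_algebra_def using curv by blast
next
  obtain c where c: "curvature br pr u0 v0 = c *\<^sub>R T"
    using curv[of u0 v0] by (auto simp: span_singleton)
  show "span {T} \<subseteq> holonomy_algebra br pr"
    unfolding holonomy_algebra_def
  proof (intro Inter_greatest, clarify)
    fix H x
    assume H: "lie_subalgebra_End H" "\<forall>v w. curvature br pr v w \<in> H" and x: "x \<in> span {T}"
    have "subspace H" using H(1) by (simp add: lie_subalgebra_End_def)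
    moreover have "c *\<^sub>R T \<in> H" using H(2) c by metis
    \<comment> \<open>\<open>nonflat\<close> forces \<open>c\<close> to be nonzero, so dividing by
      it recovers \<open>T\<close>.\<close>
    ultimately have "inverse c *\<^sub>R c *\<^sub>R T \<in> H" by (rule subspace_scale)
    then have "T \<in> H" using c nonflat by auto
    then show "x \<in> H"
      using x \<open>subspace H\<close> span_minimal[of "{T}" H] by auto
  qed
qed

lemma holonomy_algebra_line:
  assumes curv: "\<And>u v. curvature br pr u v \<in> span {T}"
    and nonflat: "curvature br pr u0 v0 \<noteq> 0"
    and inv: "\<And>u. commutator (F_conn br pr u) T \<in> span {T}"
  shows "lie_subalgebra_End (holonomy_algebra br pr)"
    and "abelian_End (holonomy_algebra br pr)"
    and "dim (holonomy_algebra br pr) = 1"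
proof -
  have hol: "holonomy_algebra br pr = span {T}"
    using assms by (rule holonomy_algebra_eq_span)
  have "T \<noteq> 0"
    using curv[of u0 v0] nonflat by (auto simp: span_singleton)
  then have "independent {T}"
    by simp
  then show "dim (holonomy_algebra br pr) = 1"
    using dim_span_eq_card_independent[of "{T}"] by (simp add: hol)
  show "abelian_End (holonomy_algebra br pr)"
    by (auto simp: abelian_End_def hol span_singleton commutator_scaleR_scaleR_self)
  then show "lie_subalgebra_End (holonomy_algebra br pr)"
    by (simp add: lie_subalgebra_End_def abelian_End_def hol span_zero)
qed

section \<open>Coordinate formulas and algebra axioms\<close>

lemma bilinear_bilinear_ext: "bilinear (bilinear_ext c)"
  unfolding bilinear_def bilinear_ext_def
  by (auto intro!: linearI simp: scaleR_sum_right sum.distrib[symmetric] algebra_simps)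

lemmas coord_defs = bilinear_ext_def sum_3 e_def axis_def vec_eq_iff forall_3

text \<open>These closed forms turn the axioms into polynomial identities, compared component by
  component.\<close>

lemma bracket_n1_eq: "bracket_n1 x y = vector [x$2 * y$3 - x$3 * y$2, 0, 0]"
  by (simp add: bracket_n1_def coord_defs)

lemma bracket_n2_eq: "bracket_n2 x y = vector [0, x$1 * y$3 - x$3 * y$1, 0]"
  by (simp add: bracket_n2_def coord_defs)

lemma prod_A3_eq: "prod_A3 x y = vector [x$2 * y$2 + x$3 * y$3, 0, 0]"
  by (simp add: prod_A3_def coord_defs)

lemma prod_A4_eq: "prod_A4 x y = vector [x$2 * y$3 + x$3 * y$2, x$3 * y$3, 0]"
  by (simp add: prod_A4_def coord_defs)

lemma prod_D1_eq: "prod_D1 x y = vector [0, x$1 * y$1, x$3 * y$3]"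
  by (simp add: prod_D1_def coord_defs)

lemma prod_D2_eq:
  "prod_D2 x y = vector [x$1 * y$3 + x$3 * y$1, x$1 * y$1 + x$2 * y$3 + x$3 * y$2, x$3 * y$3]"
  by (simp add: prod_D2_def coord_defs)

lemmas table_eqs =
  bracket_n1_eq bracket_n2_eq prod_A3_eq prod_A4_eq prod_D1_eq prod_D2_eq

lemma bilinear_tables:
  "bilinear bracket_n1" "bilinear bracket_n2"
  "bilinear prod_A3" "bilinear prod_A4" "bilinear prod_D1" "bilinear prod_D2"
  by (simp_all add: bracket_n1_def bracket_n2_def prod_A3_def prod_A4_def prod_D1_def prod_D2_def
      bilinear_bilinear_ext)

lemma e_eq: "e 1 = vector [1, 0, 0]" "e 2 = vector [0, 1, 0]" "e 3 = vector [0, 0, 1]"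
  by (simp_all add: e_def axis_def vec_eq_iff forall_3)

lemma lie_algebra_tables: "lie_algebra bracket_n1" "lie_algebra bracket_n2"
  by (simp_all add: lie_algebra_def bilinear_tables table_eqs vec_eq_iff forall_3)

text \<open>Three distinct indices exhaust the index type \<open>3\<close>, so the vectors form the
  standard basis, which supplies independence and spanning.\<close>

lemma heisenberg_algebraI:
  assumes "lie_algebra br" and "distinct [i, j, k]"
    and "br (e i) (e j) = e k" "br (e i) (e k) = 0" "br (e j) (e k) = 0"
  shows "heisenberg_algebra br"
proof -
  have "card {i, j, k} = 3"
    using assms(2) by simp
  then have ijk: "{i, j, k} = UNIV"
    by (intro card_subset_eq) auto
  have "e ` UNIV = (Basis :: (real^3) set)"
    by (auto simp: Basis_vec_def e_def)
  then have B: "{e i, e j, e k} = Basis"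
    unfolding ijk[symmetric] by simp
  then have "card {e i, e j, e k} = 3" "independent {e i, e j, e k}" "span {e i, e j, e k} = UNIV"
    by (simp_all add: independent_Basis)
  then show ?thesis
    unfolding heisenberg_algebra_def using assms by blast
qed

lemma heisenberg_algebra_tables:
  "heisenberg_algebra bracket_n1" "heisenberg_algebra bracket_n2"
  \<comment> \<open>The last index of each triple is that of the central vector: \<open>e 1\<close>
    for \<open>bracket_n1\<close>, \<open>e 2\<close> for \<open>bracket_n2\<close>.\<close>
  by (rule heisenberg_algebraI[of _ 2 3 1] heisenberg_algebraI[of _ 1 3 2];
      simp add: lie_algebra_tables table_eqs e_eq vec_eq_iff forall_3)+

lemma comm_assoc_algebra_tables:
  "comm_assoc_algebra prod_A3" "comm_assoc_algebra prod_A4"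
  "comm_assoc_algebra prod_D1" "comm_assoc_algebra prod_D2"
  by (simp_all add: comm_assoc_algebra_def bilinear_tables table_eqs vec_eq_iff forall_3 algebra_simps)

section \<open>Leibnizators and Poisson ranks\<close>

lemma leibnizator_A3: "leibnizator bracket_n1 prod_A3 u v w = 0"
  by (simp add: leibnizator_def table_eqs vec_eq_iff forall_3)

lemma leibnizator_A4: "leibnizator bracket_n1 prod_A4 u v w = (- u$3 * v$3 * w$3) *\<^sub>R e 1"
  by (simp add: leibnizator_def table_eqs e_eq vec_eq_iff forall_3)

lemma leibnizator_D1: "leibnizator bracket_n2 prod_D1 u v w = (u$1 * v$3 * w$3) *\<^sub>R e 2"
  by (simp add: leibnizator_def table_eqs e_eq vec_eq_iff forall_3)

lemma leibnizator_D2: "leibnizator bracket_n2 prod_D2 u v w = (- u$1 * v$3 * w$3) *\<^sub>R e 2"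
  by (simp add: leibnizator_def table_eqs e_eq vec_eq_iff forall_3 algebra_simps)

lemmas leibnizator_tables = leibnizator_A3 leibnizator_A4 leibnizator_D1 leibnizator_D2

lemma F_man_algebra_tables:
  "F_man_algebra bracket_n1 prod_A3" "F_man_algebra bracket_n1 prod_A4"
  "F_man_algebra bracket_n2 prod_D1" "F_man_algebra bracket_n2 prod_D2"
  by (simp_all add: F_man_algebra_def lie_algebra_tables comm_assoc_algebra_tables
      leibnizator_tables table_eqs e_eq vec_eq_iff forall_3 algebra_simps)

lemma poisson_algebra_iff_leibnizator:
  assumes "F_man_algebra br pr"
  shows "poisson_algebra br pr \<longleftrightarrow> (\<forall>u v w. leibnizator br pr u v w = 0)"
  using assms by (simp add: F_man_algebra_def poisson_algebra_def leibnizator_def diff_diff_eq)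

text \<open>The set is the hyperplane orthogonal to \<open>axis i 1\<close>.\<close>

lemma dim_coordinate_plane: "dim {u :: real^'n. u $ i = 0} = CARD('n) - 1"
  using dim_hyperplane[of "axis i (1::real)"]
  by (simp add: inner_axis' axis_eq_0_iff)

lemma pois_rank_eq_2:
  assumes L: "\<And>u v w. leibnizator br pr u v w = (c * u $ i * v $ 3 * w $ 3) *\<^sub>R (a :: real^3)"
    and "c \<noteq> 0" "a \<noteq> 0"
  shows "pois_rank br pr = 2"
proof -
  have "pois_fiber br pr = {u. u $ i = 0}"
    \<comment> \<open>Taking \<open>v = w = e 3\<close> reduces the Leibnizator to
      \<open>(c * u $ i) *\<^sub>R a\<close>.\<close>
    using assms(2,3) by (force simp: pois_fiber_def L e_eq dest: spec[of _ "e 3"])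
  then show ?thesis
    by (simp add: pois_rank_def dim_coordinate_plane)
qed

lemma pois_rank_tables:
  "pois_rank bracket_n1 prod_A4 = 2"
  "pois_rank bracket_n2 prod_D1 = 2"
  "pois_rank bracket_n2 prod_D2 = 2"
  \<comment> \<open>The instances are for A4, D1 and D2 in turn; \<open>fail\<close> rejects one
    that leaves goals open, so that the next is tried.\<close>
  by (rule pois_rank_eq_2[of _ _ "-1" 3 "e 1"] pois_rank_eq_2[of _ _ 1 1 "e 2"]
      pois_rank_eq_2[of _ _ "-1" 1 "e 2"];
      simp add: leibnizator_tables e_eq vec_eq_iff forall_3; fail)+

lemma leibnizator_nonzero:
  "leibnizator bracket_n1 prod_A4 (e 3) (e 3) (e 3) \<noteq> 0"
  "leibnizator bracket_n2 prod_D1 (e 1) (e 3) (e 3) \<noteq> 0"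
  "leibnizator bracket_n2 prod_D2 (e 1) (e 3) (e 3) \<noteq> 0"
  by (simp_all add: leibnizator_tables e_eq vec_eq_iff forall_3)

section \<open>Curvature and holonomy of the four connections\<close>

definition hol_gen :: "(real^3) \<Rightarrow>\<^sub>L (real^3)" where
  "hol_gen = Blinfun (\<lambda>x. x $ 3 *\<^sub>R e 2)"

lemma hol_gen_apply: "blinfun_apply hol_gen x = x $ 3 *\<^sub>R e 2"
  unfolding hol_gen_def
  by (rule bounded_linear_Blinfun_apply[THEN fun_cong])
    (intro bounded_linear_scaleR_left[THEN bounded_linear_compose] bounded_linear_vec_nth)

lemmas operator_eqs = curvature_apply F_conn_apply commutator_apply hol_gen_apply
  bilinear_tables blinfun.scaleR_left blinfun.minus_left blinfun.diff_left table_eqs e_eq vec_eq_iff forall_3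

text \<open>Every A_u maps into the line of \<open>e 1\<close> and kills \<open>e 1\<close>, so all
  products A_u A_v vanish; brackets lie on that line too, and A at \<open>e 1\<close> is
  zero.\<close>

lemma curvature_A3: "curvature bracket_n1 prod_A3 u v = 0"
  by (rule blinfun_eqI) (simp add: operator_eqs)

text \<open>Here A_u A_v need not vanish but is symmetric in \<open>u\<close> and \<open>v\<close>,
  and A at \<open>e 1\<close> is again zero.\<close>

lemma curvature_A4: "curvature bracket_n1 prod_A4 u v = 0"
  by (rule blinfun_eqI) (simp add: operator_eqs algebra_simps)

lemma curvature_D1:
  "curvature bracket_n2 prod_D1 u v = ((u$1 * v$3 - u$3 * v$1) / 2) *\<^sub>R hol_gen"
  by (rule blinfun_eqI) (simp add: operator_eqs field_simps)

text \<open>The sign is opposite to that for D1: the commutator term is the same, but A at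
  \<open>e 2\<close> is now \<open>hol_gen\<close> instead of zero, and the bracket term outweighs
  the commutator.\<close>

lemma curvature_D2:
  "curvature bracket_n2 prod_D2 u v = ((u$3 * v$1 - u$1 * v$3) / 2) *\<^sub>R hol_gen"
  by (rule blinfun_eqI) (simp add: operator_eqs field_simps)

text \<open>A_u kills \<open>e 2\<close> and multiplies the third coordinate by \<open>u$3\<close>,
  so only the composition with \<open>hol_gen\<close> on the left survives.\<close>

lemma commutator_F_conn_D1:
  "commutator (F_conn bracket_n2 prod_D1 u) hol_gen = (- u$3) *\<^sub>R hol_gen"
  by (rule blinfun_eqI) (simp add: operator_eqs)

text \<open>Now \<open>e 2\<close> is an eigenvector of A_u with eigenvalue \<open>u$3\<close>, so
  the two compositions cancel.\<close>

lemma commutator_F_conn_D2: "commutator (F_conn bracket_n2 prod_D2 u) hol_gen = 0"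
  by (rule blinfun_eqI) (simp add: operator_eqs)

lemma hol_gen_nonzero: "hol_gen \<noteq> 0"
  using hol_gen_apply[of "e 3"] by (auto simp: e_eq vec_eq_iff forall_3)

lemma curvature_nonzero:
  "curvature bracket_n2 prod_D1 (e 1) (e 3) \<noteq> 0"
  "curvature bracket_n2 prod_D2 (e 1) (e 3) \<noteq> 0"
  by (simp_all add: curvature_D1 curvature_D2 hol_gen_nonzero e_eq)

lemma holonomy_D1:
  "lie_subalgebra_End (holonomy_algebra bracket_n2 prod_D1)"
  "abelian_End (holonomy_algebra bracket_n2 prod_D1)"
  "dim (holonomy_algebra bracket_n2 prod_D1) = 1"
  by (rule holonomy_algebra_line[OF _ curvature_nonzero(1), of hol_gen];
      unfold curvature_D1 commutator_F_conn_D1; intro span_scale span_base singletonI)+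

lemma holonomy_D2:
  "lie_subalgebra_End (holonomy_algebra bracket_n2 prod_D2)"
  "abelian_End (holonomy_algebra bracket_n2 prod_D2)"
  "dim (holonomy_algebra bracket_n2 prod_D2) = 1"
  by (rule holonomy_algebra_line[OF _ curvature_nonzero(2), of hol_gen];
      unfold curvature_D2 commutator_F_conn_D2; intro span_zero span_scale span_base singletonI)+

theorem theorem3p18:
  shows "
    (heisenberg_algebra bracket_n1 \<and> heisenberg_algebra bracket_n2) \<and>
    (F_man_algebra bracket_n1 prod_A3 \<and>
     poisson_algebra bracket_n1 prod_A3 \<and>
     (\<forall>u v w. leibnizator bracket_n1 prod_A3 u v w = 0) \<and>
     (\<forall>u v. curvature bracket_n1 prod_A3 u v = 0)) \<and>
    (F_man_algebra bracket_n1 prod_A4 \<and>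
     \<not> poisson_algebra bracket_n1 prod_A4 \<and>
     (\<exists>u v w. leibnizator bracket_n1 prod_A4 u v w \<noteq> 0) \<and>
     pois_rank bracket_n1 prod_A4 = 2 \<and>
     (\<forall>u v. curvature bracket_n1 prod_A4 u v = 0)) \<and>
    (F_man_algebra bracket_n2 prod_D1 \<and>
     \<not> poisson_algebra bracket_n2 prod_D1 \<and>
     (\<exists>u v w. leibnizator bracket_n2 prod_D1 u v w \<noteq> 0) \<and>
     pois_rank bracket_n2 prod_D1 = 2 \<and>
     (\<exists>u v. curvature bracket_n2 prod_D1 u v \<noteq> 0) \<and>
     lie_subalgebra_End (holonomy_algebra bracket_n2 prod_D1) \<and>
     abelian_End (holonomy_algebra bracket_n2 prod_D1) \<and>
     dim (holonomy_algebra bracket_n2 prod_D1) = 1) \<and>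
    (F_man_algebra bracket_n2 prod_D2 \<and>
     \<not> poisson_algebra bracket_n2 prod_D2 \<and>
     (\<exists>u v w. leibnizator bracket_n2 prod_D2 u v w \<noteq> 0) \<and>
     pois_rank bracket_n2 prod_D2 = 2 \<and>
     (\<exists>u v. curvature bracket_n2 prod_D2 u v \<noteq> 0) \<and>
     lie_subalgebra_End (holonomy_algebra bracket_n2 prod_D2) \<and>
     abelian_End (holonomy_algebra bracket_n2 prod_D2) \<and>
     dim (holonomy_algebra bracket_n2 prod_D2) = 1)"
  using heisenberg_algebra_tables F_man_algebra_tables leibnizator_A3 leibnizator_nonzero
    poisson_algebra_iff_leibnizator curvature_A3 curvature_A4 curvature_nonzero pois_rank_tables
    holonomy_D1 holonomy_D2
  by blast

end
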